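(* For every integer $\Delta\geq 3$ there exist $c,n_0>0$ such that for every $n\geq n_0$ with $\Delta n$ even, if $G_{n,\Delta}$ is a graph chosen uniformly at random among all $\Delta$-regular graphs on the vertex set $[n]$, then $$\mathbb{P}(G_{n,\Delta}\text{ has a frozen }(\Delta+1)\text{-colouring})\leq e^{-cn}.$$
   Context: All graphs are finite, simple and labeled, with vertex set $[n]=\{1,\dots,n\}$. A (proper) $k$-colouring of $G$ is a function $\alpha:V(G)\to[k]$ with $\alpha(x)\neq\alpha(y)$ for every edge $xy$. For $G$ of maximum degree $\Delta$, a proper $(\Delta+1)$-colouring of $G$ is frozen if for every vertex $v$ all $\Delta+1$ colours appear in the closed neighbourhood $N[v]=N(v)\cup\{v\}$. *)

theory Defs
  imports "HOL-Probability.Probability" "HOL-Library.Ramsey"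
begin

type_synonym edges = "nat set set"

definition simple_graphs :: "nat \<Rightarrow> edges set" where
  "simple_graphs n = {E. E \<subseteq> nsets {1..n} 2}"

definition nbhd :: "edges \<Rightarrow> nat \<Rightarrow> nat set" where
  "nbhd E v = {w. {v, w} \<in> E}"

definition closed_nbhd :: "edges \<Rightarrow> nat \<Rightarrow> nat set" where
  "closed_nbhd E v = insert v (nbhd E v)"

definition regular_graphs :: "nat \<Rightarrow> nat \<Rightarrow> edges set" where
  "regular_graphs n d = {E \<in> simple_graphs n. \<forall>v\<in>{1..n}. card (nbhd E v) = d}"

definition proper_colouring :: "nat \<Rightarrow> edges \<Rightarrow> nat \<Rightarrow> (nat \<Rightarrow> nat) \<Rightarrow> bool" where
  "proper_colouring n E k \<alpha> \<longleftrightarrow>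
     \<alpha> \<in> {1..n} \<rightarrow>\<^sub>E {1..k} \<and> (\<forall>x y. {x, y} \<in> E \<longrightarrow> \<alpha> x \<noteq> \<alpha> y)"

(* Meant for k = D + 1, where D is the maximum degree of the graph. *)
definition frozen_colouring :: "nat \<Rightarrow> edges \<Rightarrow> nat \<Rightarrow> (nat \<Rightarrow> nat) \<Rightarrow> bool" where
  "frozen_colouring n E k \<alpha> \<longleftrightarrow>
     proper_colouring n E k \<alpha> \<and> (\<forall>v\<in>{1..n}. {1..k} \<subseteq> \<alpha> ` closed_nbhd E v)"

(* pmf_of_set is the uniform distribution only on a finite nonempty set; regular_graphs n d
   is finite, and nonempty whenever d < n and d * n is even. *)
definition random_regular_graph :: "nat \<Rightarrow> nat \<Rightarrow> edges pmf" where
  "random_regular_graph n d = pmf_of_set (regular_graphs n d)"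

end

theory Submission
  imports Defs "HOL-Real_Asymp.Real_Asymp"
begin

text \<open>
  First moment method. If \<open>G\<close> is \<open>\<Delta>\<close>-regular with a frozen colouring, then every vertex has exactly
  one neighbour in each other colour, so the \<open>\<Delta> + 1\<close> colour classes have equal size \<open>m\<close> and any two
  of them span a perfect matching. With \<open>R = \<Delta>(\<Delta> + 1)/2\<close> there are thus at most
  \<open>(\<Delta> + 1)\<^sup>n (m!)\<^sup>R\<close> such graphs, and the number of edges is \<open>N = Rm\<close>.

  The number of all \<open>\<Delta>\<close>-regular graphs is only needed up to a polynomial factor, where a direct
  argument replaces the configuration model: weight a graph of maximum degree at most \<open>\<Delta>\<close> by the
  number of configurations representing it, and add edges one by one. A graph with deficiency \<open>T\<close>
  rules out at most \<open>\<Delta>(\<Delta> + 1)T\<close> of the \<open>T\<^sup>2\<close> ordered pairs of free points, so the total weight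
  grows as it should until only \<open>R\<close> edges are missing; these are supplied by switchings, each of
  which costs a factor \<open>n\<^sup>6\<close>. Comparing both counts leaves the rate
  \<open>(\<Delta> + 1)! / (\<Delta>(\<Delta> + 1))\<^bsup>\<Delta>/2\<^esup> < 1\<close>.
\<close>

section \<open>Degrees and double counting of edges\<close>

abbreviation deg :: "edges \<Rightarrow> nat \<Rightarrow> nat" where
  "deg E v \<equiv> card (nbhd E v)"

lemma nbhd_sym: "w \<in> nbhd E v \<longleftrightarrow> v \<in> nbhd E w"
  by (simp add: nbhd_def insert_commute)

lemma nbhd_subset: "E \<in> simple_graphs n \<Longrightarrow> nbhd E v \<subseteq> {1..n} - {v}"
  unfolding simple_graphs_def nbhd_def
  by (smt (verit) Diff_iff doubleton_in_nsets_2 empty_iff insert_iff mem_Collect_eq subset_iff)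

lemma finite_nbhd: "E \<in> simple_graphs n \<Longrightarrow> finite (nbhd E v)"
  using nbhd_subset finite_subset by (metis finite_Diff finite_atLeastAtMost)

lemma finite_nsets_atLeastAtMost: "finite (nsets {1..n::nat} k)"
  by (simp add: finite_imp_finite_nsets)

lemma finite_simple_graphs: "finite (simple_graphs n)"
  unfolding simple_graphs_def Pow_def[symmetric]
  by (simp only: finite_Pow_iff finite_nsets_atLeastAtMost)

lemma finite_simple_graph: "E \<in> simple_graphs n \<Longrightarrow> finite E"
  unfolding simple_graphs_def using finite_nsets_atLeastAtMost finite_subset by blast

lemma simple_graph_edgeE:
  assumes "E \<in> simple_graphs n" "e \<in> E"
  obtains x y where "e = {x, y}" "x \<in> {1..n}" "y \<in> {1..n}" "x \<noteq> y"
  using assms unfolding simple_graphs_def by (auto elim!: nsets2_E)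

text \<open>Each edge is reached from both of its ends. A general \<open>g\<close> is kept because
  two cases are needed: the constant 1 for the handshake identity, and products of deficiencies over
  the non-edges, seen as the edges of the complement graph.\<close>

lemma sum_nbhd:
  fixes g :: "nat set \<Rightarrow> 'a::comm_semiring_1"
  assumes "E \<in> simple_graphs n"
  shows "(\<Sum>v=1..n. \<Sum>w\<in>nbhd E v. g {v, w}) = 2 * (\<Sum>e\<in>E. g e)"
proof -
  have "(\<Sum>w\<in>nbhd E v. g {v, w}) = (\<Sum>e | e \<in> E \<and> v \<in> e. g e)" for v
  proof (rule sum.reindex_bij_betw)
    show "bij_betw (\<lambda>w. {v, w}) (nbhd E v) {e \<in> E. v \<in> e}"
    proof (rule bij_betw_imageI)
      show "inj_on (\<lambda>w. {v, w}) (nbhd E v)"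
        by (auto simp: inj_on_def doubleton_eq_iff)
      show "(\<lambda>w. {v, w}) ` nbhd E v = {e \<in> E. v \<in> e}"
      proof safe
        fix e assume "e \<in> E" "v \<in> e"
        moreover from this obtain x y where "e = {x, y}"
          using assms simple_graph_edgeE by blast
        ultimately show "e \<in> (\<lambda>w. {v, w}) ` nbhd E v"
          by (auto simp: nbhd_def insert_commute)
      qed (auto simp: nbhd_def)
    qed
  qed
  then have "(\<Sum>v=1..n. \<Sum>w\<in>nbhd E v. g {v, w}) = (\<Sum>v=1..n. \<Sum>e | e \<in> E \<and> v \<in> e. g e)"
    by simp
  also have "\<dots> = (\<Sum>e\<in>E. \<Sum>v | v \<in> {1..n} \<and> v \<in> e. g e)"
    using finite_simple_graph[OF assms] by (intro sum.swap_restrict) auto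
  also have "\<dots> = (\<Sum>e\<in>E. 2 * g e)"
  proof (rule sum.cong)
    fix e assume "e \<in> E"
    then obtain x y where "e = {x, y}" "x \<in> {1..n}" "y \<in> {1..n}" "x \<noteq> y"
      using assms simple_graph_edgeE by blast
    moreover from this have "{v. v \<in> {1..n} \<and> v \<in> e} = {x, y}" by auto
    ultimately show "(\<Sum>v | v \<in> {1..n} \<and> v \<in> e. g e) = 2 * g e"
      by (simp add: mult_2)
  qed simp
  finally show ?thesis by (simp add: sum_distrib_left)
qed

lemma handshake: "E \<in> simple_graphs n \<Longrightarrow> (\<Sum>v=1..n. deg E v) = 2 * card E"
  using sum_nbhd[of E n "\<lambda>_. 1 :: nat"] by simp

lemma deg_insert:
  assumes "E \<in> simple_graphs n" "x \<noteq> y" "{x, y} \<notin> E"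
  shows "deg (insert {x, y} E) v = deg E v + of_bool (v = x \<or> v = y)"
proof -
  have "nbhd (insert {x, y} E) v =
      (if v = x then insert y (nbhd E v) else if v = y then insert x (nbhd E v) else nbhd E v)"
    by (auto simp: nbhd_def doubleton_eq_iff)
  moreover have "x \<notin> nbhd E y" "y \<notin> nbhd E x"
    using assms(3) by (auto simp: nbhd_def insert_commute)
  ultimately show ?thesis
    using assms(2) finite_nbhd[OF assms(1)] by auto
qed

section \<open>Graphs of bounded degree with a given number of edges\<close>

definition bounded_graphs :: "nat \<Rightarrow> nat \<Rightarrow> nat \<Rightarrow> edges set" where
  "bounded_graphs n D k =
    {E \<in> simple_graphs n. (\<forall>v\<in>{1..n}. deg E v \<le> D) \<and> card E = k}"

lemma finite_bounded_graphs: "finite (bounded_graphs n D k)"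
  unfolding bounded_graphs_def by (simp add: finite_simple_graphs)

lemma bounded_graphsD:
  assumes "E \<in> bounded_graphs n D k"
  shows "E \<in> simple_graphs n" "v \<in> {1..n} \<Longrightarrow> deg E v \<le> D" "card E = k" "finite E"
  using assms finite_simple_graph unfolding bounded_graphs_def by auto

lemma bounded_graphs_deg_le:
  assumes "E \<in> bounded_graphs n D k"
  shows "deg E v \<le> D"
proof (cases "v \<in> {1..n}")
  case False
  have "nbhd E v = {}"
    using False nbhd_subset[OF bounded_graphsD(1)[OF assms]] nbhd_sym by blast
  then show ?thesis by simp
qed (use bounded_graphsD[OF assms] in auto)

lemma card_closed_nbhd_le:
  assumes "E \<in> bounded_graphs n D k"
  shows "card (closed_nbhd E v) \<le> D + 1"
  using bounded_graphs_deg_le[OF assms, of v] card_insert_le_m1[of "Suc D" "nbhd E v" v]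
  by (simp add: closed_nbhd_def)

text \<open>With \<open>N\<close> edges the degree sum attains its maximum \<open>D * n\<close>, so
  no vertex can stay below \<open>D\<close>.\<close>

lemma bounded_graphs_eq_regular_graphs:
  assumes "D * n = 2 * N"
  shows "bounded_graphs n D N = regular_graphs n D"
proof (intro equalityI subsetI)
  fix E assume E: "E \<in> bounded_graphs n D N"
  note B = bounded_graphsD[OF E]
  have "deg E v = D" if "v \<in> {1..n}" for v
  proof (rule ccontr)
    assume "deg E v \<noteq> D"
    then have "(\<Sum>v=1..n. deg E v) < (\<Sum>v=1..n. D)"
      using B(2) that by (intro sum_strict_mono_ex1) (auto intro!: bexI[of _ v] simp: order.strict_iff_order)
    then show False
      using handshake[OF B(1)] B(3) assms by (simp add: mult.commute)
  qed
  then show "E \<in> regular_graphs n D"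
    using B(1) by (simp add: regular_graphs_def)
next
  fix E assume "E \<in> regular_graphs n D"
  then have "E \<in> simple_graphs n" and *: "\<forall>v\<in>{1..n}. deg E v = D"
    by (auto simp: regular_graphs_def)
  moreover have "2 * card E = (\<Sum>v=1..n. D)"
    using handshake[OF \<open>E \<in> simple_graphs n\<close>] * by simp
  ultimately show "E \<in> bounded_graphs n D N"
    using assms by (simp add: bounded_graphs_def mult.commute)
qed

subsection \<open>Switchings\<close>

text \<open>At most \<open>card B * D\<close> edges meet \<open>B\<close>, so some further edge
  misses it.\<close>

lemma edge_avoiding:
  assumes "E \<in> bounded_graphs n D k" "finite B" "card B * D < k"
  obtains u v where "{u, v} \<in> E" "u \<noteq> v" "u \<notin> B" "v \<notin> B"
proof -
  note E = bounded_graphsD[OF assms(1)]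
  have "\<exists>e\<in>E. e \<inter> B = {}"
  proof (rule ccontr)
    assume *: "\<not> (\<exists>e\<in>E. e \<inter> B = {})"
    have "E \<subseteq> (\<Union>b\<in>B. (\<lambda>w. {b, w}) ` nbhd E b)"
    proof
      fix e assume "e \<in> E"
      then obtain b where b: "b \<in> e" "b \<in> B" using * by blast
      obtain x y where "e = {x, y}"
        using \<open>e \<in> E\<close> E(1) simple_graph_edgeE by blast
      then obtain w where "e = {b, w}" using b by blast
      then show "e \<in> (\<Union>b\<in>B. (\<lambda>w. {b, w}) ` nbhd E b)"
        using \<open>e \<in> E\<close> b by (auto simp: nbhd_def)
    qed
    then have "card E \<le> card (\<Union>b\<in>B. (\<lambda>w. {b, w}) ` nbhd E b)"
      using assms(2) finite_nbhd[OF E(1)] by (intro card_mono) auto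
    also have "\<dots> \<le> (\<Sum>b\<in>B. card ((\<lambda>w. {b, w}) ` nbhd E b))"
      by (rule card_UN_le[OF assms(2)])
    also have "\<dots> \<le> (\<Sum>b\<in>B. D)"
      by (intro sum_mono order.trans[OF card_image_le[OF finite_nbhd[OF E(1)]]]
          bounded_graphs_deg_le[OF assms(1)])
    finally show False using assms(3) E(3) by simp
  qed
  then obtain e where e: "e \<in> E" "e \<inter> B = {}" by blast
  then obtain u v where "e = {u, v}" "u \<noteq> v"
    using E(1) simple_graph_edgeE by metis
  with e show thesis by (intro that[of u v]) auto
qed

text \<open>The degrees fall short of \<open>D * n\<close> by at least 2 in total: either one vertex
  lacks two edges (\<open>x = y\<close>) or two vertices lack one each. The \<open>of_bool\<close>
  terms treat both cases at once.\<close>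

lemma deficient_vertices:
  assumes "E \<in> bounded_graphs n D k" "2 * k + 2 \<le> D * n"
  obtains x y where "x \<in> {1..n}" "y \<in> {1..n}"
    "\<And>z. deg E z + of_bool (z = x) + of_bool (z = y) \<le> D"
proof -
  note E = bounded_graphsD[OF assms(1)]
  note le = bounded_graphs_deg_le[OF assms(1)]
  have sum: "(\<Sum>v=1..n. D - deg E v) \<ge> 2"
    using assms(2) handshake[OF E(1)] E(2,3) by (subst sum_subtractf_nat) (auto simp: mult.commute)
  then obtain x where x: "x \<in> {1..n}" "D - deg E x \<noteq> 0"
    by (metis not_numeral_le_zero sum.not_neutral_contains_not_neutral)
  show thesis
  proof (cases "deg E x + 2 \<le> D")
    case True
    then show thesis using that[of x x] x le by (auto simp: of_bool_def)
  next
    case False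
    have "(\<Sum>v=1..n. D - deg E v) = (D - deg E x) + (\<Sum>v\<in>{1..n} - {x}. D - deg E v)"
      using x(1) by (intro sum.remove) auto
    with False sum have "(\<Sum>v\<in>{1..n} - {x}. D - deg E v) \<noteq> 0" by linarith
    then obtain y where "y \<in> {1..n} - {x}" "D - deg E y \<noteq> 0"
      by (metis sum.not_neutral_contains_not_neutral)
    then show thesis
      using that[of x y] x le by (auto simp: of_bool_def)
  qed
qed

text \<open>Replacing an edge \<open>uv\<close> far away from two deficient vertices \<open>x\<close>, \<open>y\<close> by \<open>xu\<close> and
  \<open>yv\<close> gains one edge; \<open>x = y\<close> is allowed.\<close>

lemma switching:
  assumes "E \<in> bounded_graphs n D k" "2 * k + 2 \<le> D * n" "2 * (D + 1) * D < k"
  shows "\<exists>E'\<in>bounded_graphs n D (Suc k). \<exists>e\<in>nsets {1..n} 2. \<exists>e1\<in>nsets {1..n} 2.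
    \<exists>e2\<in>nsets {1..n} 2. E = insert e (E' - {e1, e2})"
proof -
  note E = bounded_graphsD[OF assms(1)]
  obtain x y where xy: "x \<in> {1..n}" "y \<in> {1..n}"
    "\<And>z. deg E z + of_bool (z = x) + of_bool (z = y) \<le> D"
    using deficient_vertices[OF assms(1,2)] by blast
  have fin: "finite (closed_nbhd E z)" for z
    by (simp add: closed_nbhd_def finite_nbhd[OF E(1)])
  \<comment> \<open>Outside \<open>B\<close>, the vertices \<open>u\<close> and \<open>v\<close>
    differ from \<open>x\<close> and \<open>y\<close> and are adjacent to neither, so
    \<open>xu\<close> and \<open>yv\<close> are new edges. The bound on \<open>card B\<close>
    explains the hypothesis on \<open>k\<close>.\<close>
  define B where "B = closed_nbhd E x \<union> closed_nbhd E y"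
  have "card B \<le> 2 * (D + 1)"
    unfolding B_def using card_closed_nbhd_le[OF assms(1), of x] card_closed_nbhd_le[OF assms(1), of y]
    by (intro order.trans[OF card_Un_le]) auto
  then have "card B * D < k"
    using assms(3) by (metis le_less_trans mult_le_mono1)
  then obtain u v where uv: "{u, v} \<in> E" "u \<noteq> v" "u \<notin> B" "v \<notin> B"
    using edge_avoiding[OF assms(1)] fin by (metis B_def finite_UnI)
  have uvn: "u \<in> {1..n}" "v \<in> {1..n}"
    using uv(1) E(1) by (auto simp: simple_graphs_def)
  have new: "{x, u} \<notin> E" "{y, v} \<notin> E" "x \<noteq> u" "y \<noteq> v" "x \<noteq> v" "y \<noteq> u"
    using uv(3,4) by (auto simp: B_def closed_nbhd_def nbhd_def)
  define E1 where "E1 = E - {{u, v}}"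
  define E2 where "E2 = insert {y, v} E1"
  define E3 where "E3 = insert {x, u} E2"
  have E1: "E1 \<in> simple_graphs n" "E = insert {u, v} E1" "{u, v} \<notin> E1"
    using E(1) uv by (auto simp: E1_def simple_graphs_def)
  have E2: "E2 \<in> simple_graphs n" "{y, v} \<notin> E1"
    using E1 new uvn xy by (auto simp: E2_def simple_graphs_def)
  have E3: "E3 \<in> simple_graphs n" "{x, u} \<notin> E2"
    using E1 E2 new uvn xy uv by (auto simp: E2_def E3_def simple_graphs_def doubleton_eq_iff)
  \<comment> \<open>Both \<open>u\<close> and \<open>v\<close> lose one edge and gain one; only
    \<open>x\<close> and \<open>y\<close> gain, by 2 if they coincide.\<close>
  have "deg E3 z = deg E z + of_bool (z = x) + of_bool (z = y)" for z
    using deg_insert[OF E1(1) uv(2) E1(3), of z] deg_insert[OF E1(1) new(4) E2(2), of z]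
      deg_insert[OF E2(1) new(3) E3(2), of z] new uv(2)
    unfolding E1(2)[symmetric] E2_def[symmetric] E3_def[symmetric]
    by (auto simp: of_bool_def split: if_splits)
  then have "\<forall>z\<in>{1..n}. deg E3 z \<le> D" using xy(3) by simp
  moreover have "card E3 = Suc k"
    using E(3) E1 E2 E3 finite_simple_graph[OF E1(1)] by (simp add: E2_def E3_def)
  ultimately have "E3 \<in> bounded_graphs n D (Suc k)"
    using E3(1) by (simp add: bounded_graphs_def)
  moreover have "E = insert {u, v} (E3 - {{x, u}, {y, v}})"
    using E1 E2(2) E3(2) by (auto simp: E3_def E2_def)
  moreover have "{u, v} \<in> nsets {1..n} 2" "{x, u} \<in> nsets {1..n} 2" "{y, v} \<in> nsets {1..n} 2"
    using uvn xy uv new by auto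
  ultimately show ?thesis by blast
qed

text \<open>The switched graph and the three pairs involved determine the original graph, and each
  pair has at most n^2 choices.\<close>

lemma card_bounded_graphs_le_Suc:
  assumes "2 * k + 2 \<le> D * n" "2 * (D + 1) * D < k"
  shows "card (bounded_graphs n D k) \<le> n ^ 6 * card (bounded_graphs n D (Suc k))"
proof -
  let ?P = "nsets {1..n} 2" and ?B = "bounded_graphs n D (Suc k)"
  have fin: "finite (?B \<times> ?P \<times> ?P \<times> ?P)"
    by (intro finite_cartesian_product finite_bounded_graphs finite_nsets_atLeastAtMost)
  have "bounded_graphs n D k \<subseteq> (\<lambda>(E', e, e1, e2). insert e (E' - {e1, e2})) ` (?B \<times> ?P \<times> ?P \<times> ?P)"
  proof
    fix E assume "E \<in> bounded_graphs n D k"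
    from switching[OF this assms] obtain E' e e1 e2 where
      "(E', e, e1, e2) \<in> ?B \<times> ?P \<times> ?P \<times> ?P" "E = insert e (E' - {e1, e2})"
      by blast
    then show "E \<in> (\<lambda>(E', e, e1, e2). insert e (E' - {e1, e2})) ` (?B \<times> ?P \<times> ?P \<times> ?P)"
      by (intro image_eqI[of _ _ "(E', e, e1, e2)"]) simp_all
  qed
  then have "card (bounded_graphs n D k) \<le> card (?B \<times> ?P \<times> ?P \<times> ?P)"
    by (rule surj_card_le[OF fin])
  also have "\<dots> = card ?B * (n choose 2) ^ 3"
    by (simp add: card_cartesian_product card_nsets power3_eq_cube)
  also have "n choose 2 \<le> n ^ 2"
    by (cases "2 \<le> n") (auto simp: binomial_le_pow binomial_eq_0)
  then have "card ?B * (n choose 2) ^ 3 \<le> card ?B * (n ^ 2) ^ 3"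
    by (intro mult_le_mono2 power_mono) auto
  finally show ?thesis by (simp add: mult.commute)
qed

text \<open>\<open>R\<close> successive switchings lead to \<open>N\<close> edges. The edge number
  only grows, so the lower bound required for a switching persists.\<close>

lemma card_bounded_graphs_le_regular_graphs:
  assumes "D * n = 2 * N" "R \<le> N" "2 * (D + 1) * D < N - R"
  shows "card (bounded_graphs n D (N - R)) \<le> n ^ (6 * R) * card (regular_graphs n D)"
  using assms(2,3)
proof (induction R)
  case 0
  then show ?case by (simp add: bounded_graphs_eq_regular_graphs[OF assms(1)])
next
  case (Suc R)
  have "card (bounded_graphs n D (N - Suc R)) \<le> n ^ 6 * card (bounded_graphs n D (Suc (N - Suc R)))"
    using Suc.prems assms(1) by (intro card_bounded_graphs_le_Suc) auto
  also have "Suc (N - Suc R) = N - R" using Suc.prems by simp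
  also have "n ^ 6 * card (bounded_graphs n D (N - R)) \<le> n ^ 6 * (n ^ (6 * R) * card (regular_graphs n D))"
    using Suc by (intro mult_le_mono2) auto
  finally show ?case by (simp add: power_add algebra_simps)
qed


subsection \<open>The number of regular graphs\<close>

text \<open>The number of ways to attach the edges of \<open>E\<close> to points if every vertex carries \<open>D\<close> points.\<close>

definition weight :: "nat \<Rightarrow> nat \<Rightarrow> edges \<Rightarrow> real" where
  "weight n D E = (\<Prod>v=1..n. fact D / fact (D - deg E v))"

lemma weight_pos: "weight n D E > 0"
  unfolding weight_def by (intro prod_pos) simp

lemma weight_le: "weight n D E \<le> fact D ^ n"
proof -
  have "weight n D E \<le> (\<Prod>v=1..n. fact D)"
    unfolding weight_def by (intro prod_mono) (auto simp: divide_le_eq fact_ge_1)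
  then show ?thesis by simp
qed

lemma weight_empty: "weight n D {} = 1"
  by (simp add: weight_def nbhd_def)

text \<open>The new edge takes one of the \<open>D - deg E v\<close> free points at each of its two
  ends.\<close>

lemma weight_insert:
  assumes "E \<in> simple_graphs n" "x \<noteq> y" "{x, y} \<notin> E" "x \<in> {1..n}" "y \<in> {1..n}"
    "deg E x < D" "deg E y < D"
  shows "weight n D (insert {x, y} E) = weight n D E * (\<Prod>v\<in>{x, y}. real (D - deg E v))"
proof -
  let ?c = "\<lambda>v. if v \<in> {x, y} then real (D - deg E v) else 1"
  have "fact D / fact (D - deg (insert {x, y} E) v) = (fact D / fact (D - deg E v)) * ?c v" for v
  proof (cases "v \<in> {x, y}")
    case True
    then have "D - deg E v = Suc (D - deg (insert {x, y} E) v)"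
      using assms(6,7) deg_insert[OF assms(1-3), of v] by auto
    then show ?thesis using True by (simp del: insert_iff)
  qed (use deg_insert[OF assms(1-3), of v] in auto)
  then have "weight n D (insert {x, y} E) = weight n D E * (\<Prod>v=1..n. ?c v)"
    by (simp only: weight_def prod.distrib)
  also have "(\<Prod>v=1..n. ?c v) = (\<Prod>v\<in>{1..n} \<inter> {x, y}. real (D - deg E v))"
    by (rule prod.inter_restrict[symmetric]) simp
  also have "{1..n} \<inter> {x, y} = {x, y}"
    using assms(4,5) by auto
  finally show ?thesis .
qed

text \<open>\<open>T\<close> is the number of free points. Once the first point is chosen at
  \<open>v\<close>, the second may be any free point outside the closed neighbourhood of
  \<open>v\<close>, which carries at most D(D + 1) points. The factor 2 passes from unordered to
  ordered pairs.\<close>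

lemma sum_nonedges_ge:
  assumes "E \<in> bounded_graphs n D k"
  defines "T \<equiv> real (D * n) - 2 * real k"
  shows "2 * (\<Sum>e\<in>nsets {1..n} 2 - E. \<Prod>v\<in>e. real (D - deg E v)) \<ge> T * (T - real (D * (D + 1)))"
proof -
  note E = bounded_graphsD[OF assms(1)]
  let ?f = "\<lambda>v. real (D - deg E v)"
  let ?F = "nsets {1..n} 2 - E"
  have T: "(\<Sum>v=1..n. ?f v) = T"
  proof -
    have "(\<Sum>v=1..n. ?f v) = (\<Sum>v=1..n. real D - real (deg E v))"
      using E(2) by (intro sum.cong) (auto simp: of_nat_diff)
    also have "\<dots> = real (D * n) - real (\<Sum>v=1..n. deg E v)"
      by (simp add: sum_subtractf mult.commute)
    finally show ?thesis
      unfolding handshake[OF E(1)] E(3) T_def by simp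
  qed
  have nbhd: "nbhd ?F v = {1..n} - closed_nbhd E v" if "v \<in> {1..n}" for v
    using that by (auto simp: nbhd_def closed_nbhd_def)
  have "T - real (D * (D + 1)) \<le> (\<Sum>w\<in>nbhd ?F v. ?f w)" if v: "v \<in> {1..n}" for v
  proof -
    have sub: "closed_nbhd E v \<subseteq> {1..n}"
      using v nbhd_subset[OF E(1), of v] by (auto simp: closed_nbhd_def)
    have "(\<Sum>w\<in>closed_nbhd E v. ?f w) \<le> (\<Sum>w\<in>closed_nbhd E v. real D)"
      by (intro sum_mono) simp
    also have "\<dots> = real (card (closed_nbhd E v) * D)" by simp
    also have "\<dots> \<le> real ((D + 1) * D)"
      using card_closed_nbhd_le[OF assms(1)] by (intro of_nat_mono mult_le_mono1)
    finally have "(\<Sum>w\<in>closed_nbhd E v. ?f w) \<le> real (D * (D + 1))"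
      by (simp only: mult.commute)
    then show ?thesis
      unfolding nbhd[OF v] using sum_diff[OF finite_atLeastAtMost sub, of ?f] T by linarith
  qed
  then have "(\<Sum>v=1..n. ?f v * (T - real (D * (D + 1)))) \<le> (\<Sum>v=1..n. ?f v * (\<Sum>w\<in>nbhd ?F v. ?f w))"
    by (intro sum_mono mult_left_mono) auto
  also have "\<dots> = (\<Sum>v=1..n. \<Sum>w\<in>nbhd ?F v. \<Prod>z\<in>{v, w}. ?f z)"
  proof (intro sum.cong refl)
    fix v assume "v \<in> {1..n}"
    then have "(\<Prod>z\<in>{v, w}. ?f z) = ?f v * ?f w" if "w \<in> nbhd ?F v" for w
      using that nbhd[of v] by (auto simp: closed_nbhd_def)
    then show "?f v * (\<Sum>w\<in>nbhd ?F v. ?f w) = (\<Sum>w\<in>nbhd ?F v. \<Prod>z\<in>{v, w}. ?f z)"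
      unfolding sum_distrib_left by (intro sum.cong) auto
  qed
  also have "\<dots> = 2 * (\<Sum>e\<in>?F. \<Prod>v\<in>e. ?f v)"
    by (rule sum_nbhd) (auto simp: simple_graphs_def)
  finally show ?thesis
    unfolding sum_distrib_right[symmetric] T .
qed

text \<open>This is the number of matchings with \<open>k\<close> pairs on \<open>D * n\<close>
  points that project to simple graphs.\<close>

definition total_weight :: "nat \<Rightarrow> nat \<Rightarrow> nat \<Rightarrow> real" where
  "total_weight n D k = (\<Sum>E\<in>bounded_graphs n D k. weight n D E)"

lemma total_weight_0: "total_weight n D 0 \<ge> 1"
proof -
  have "{} \<in> bounded_graphs n D 0"
    by (auto simp: bounded_graphs_def simple_graphs_def nbhd_def)
  then have "weight n D {} \<le> total_weight n D 0"
    unfolding total_weight_def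
    by (intro member_le_sum finite_bounded_graphs less_imp_le[OF weight_pos])
  then show ?thesis by (simp add: weight_empty)
qed

text \<open>Each graph with \<open>k + 1\<close> edges arises from \<open>k + 1\<close> pairs of a graph with \<open>k\<close> edges and
  a non-edge; by \<open>weight_insert\<close> only non-edges between deficient vertices contribute.\<close>

lemma total_weight_Suc_ge_sum_nonedges:
  "real (k + 1) * total_weight n D (Suc k) \<ge>
    (\<Sum>E\<in>bounded_graphs n D k. weight n D E *
      (\<Sum>e\<in>nsets {1..n} 2 - E. \<Prod>v\<in>e. real (D - deg E v)))"
proof -
  let ?S = "bounded_graphs n D k" and ?S' = "bounded_graphs n D (Suc k)"
  let ?P = "nsets {1..n} 2"
  define A where "A E = {e \<in> ?P - E. \<forall>v\<in>e. deg E v < D}" for E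
  have fin: "finite (A E)" for E
    by (rule finite_subset[OF _ finite_nsets_atLeastAtMost[of n 2]]) (auto simp: A_def)
  have *: "insert e E \<in> ?S' \<and> weight n D (insert e E) = weight n D E * (\<Prod>v\<in>e. real (D - deg E v))"
    if E_in: "E \<in> ?S" and e_in: "e \<in> A E" for E e
  proof -
    note E = bounded_graphsD[OF E_in]
    obtain x y where xy: "e = {x, y}" "x \<in> {1..n}" "y \<in> {1..n}" "x \<noteq> y"
      using e_in by (auto simp: A_def elim!: nsets2_E)
    have d: "e \<notin> E" "deg E x < D" "deg E y < D"
      using e_in xy by (auto simp: A_def)
    have "deg (insert e E) v \<le> D" if "v \<in> {1..n}" for v
      using deg_insert[OF E(1) xy(4), of v] d E(2)[OF that] by (auto simp: xy(1))
    moreover have "insert e E \<in> simple_graphs n"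
      using E(1) xy by (auto simp: simple_graphs_def)
    ultimately have "insert e E \<in> ?S'"
      using E(3,4) d(1) by (simp add: bounded_graphs_def)
    then show ?thesis
      using weight_insert[OF E(1) xy(4) _ xy(2,3) d(2,3)] d(1) by (simp only: xy(1)) simp
  qed
  have "(\<Sum>E\<in>?S. weight n D E * (\<Sum>e\<in>?P - E. \<Prod>v\<in>e. real (D - deg E v)))
      = (\<Sum>E\<in>?S. \<Sum>e\<in>A E. weight n D (insert e E))"
  proof (rule sum.cong)
    fix E assume E: "E \<in> ?S"
    have "(\<Sum>e\<in>?P - E. \<Prod>v\<in>e. real (D - deg E v)) = (\<Sum>e\<in>A E. \<Prod>v\<in>e. real (D - deg E v))"
    proof (intro sum.mono_neutral_right ballI)
      fix e assume "e \<in> ?P - E - A E"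
      then obtain v where "v \<in> e" "D - deg E v = 0" "finite e"
        by (auto simp: A_def nsets_def)
      then show "(\<Prod>v\<in>e. real (D - deg E v)) = 0"
        by (intro prod_zero) auto
    qed (auto simp: A_def finite_imp_finite_nsets)
    then show "weight n D E * (\<Sum>e\<in>?P - E. \<Prod>v\<in>e. real (D - deg E v)) =
        (\<Sum>e\<in>A E. weight n D (insert e E))"
      using *[OF E] by (simp add: sum_distrib_left)
  qed simp
  also have "\<dots> = (\<Sum>(E, e)\<in>(SIGMA E:?S. A E). weight n D (insert e E))"
    by (rule sum.Sigma) (auto simp: finite_bounded_graphs fin)
  also have "\<dots> \<le> (\<Sum>(E', e)\<in>(SIGMA E':?S'. E'). weight n D E')"
  \<comment> \<open>Deleting \<open>e\<close> again recovers \<open>E\<close>, so distinct pairs (E,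
    e) yield distinct pairs (E', e).\<close>
  proof (rule sum_le_included[where i = "\<lambda>(E', e). (E' - {e}, e)"])
    show "finite (SIGMA E:?S. A E)"
      using finite_bounded_graphs fin by blast
    show "finite (SIGMA E':?S'. E')"
      using finite_bounded_graphs bounded_graphsD(4) by blast
    show "\<forall>p\<in>SIGMA E':?S'. E'. 0 \<le> (case p of (E', e) \<Rightarrow> weight n D E')"
      by (auto intro: less_imp_le[OF weight_pos])
    show "\<forall>p\<in>SIGMA E:?S. A E. \<exists>q\<in>SIGMA E':?S'. E'. (case q of (E', e) \<Rightarrow> (E' - {e}, e)) = p \<and>
        (case p of (E, e) \<Rightarrow> weight n D (insert e E)) \<le> (case q of (E', e) \<Rightarrow> weight n D E')"
    proof safe
      fix E e assume "E \<in> ?S" "e \<in> A E"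
      then show "\<exists>q\<in>SIGMA E':?S'. E'. (case q of (E', e) \<Rightarrow> (E' - {e}, e)) = (E, e) \<and>
          weight n D (insert e E) \<le> (case q of (E', e) \<Rightarrow> weight n D E')"
        using * by (intro bexI[of _ "(insert e E, e)"]) (auto simp: A_def)
    qed
  qed
  also have "\<dots> = (\<Sum>E'\<in>?S'. \<Sum>e\<in>E'. weight n D E')"
    by (rule sum.Sigma[symmetric]) (auto simp: finite_bounded_graphs bounded_graphsD(4))
  also have "\<dots> = real (k + 1) * total_weight n D (Suc k)"
    using bounded_graphsD(3) by (simp add: total_weight_def sum_distrib_left)
  finally show ?thesis .
qed

text \<open>Here the number of free points is T = 2(N - k), and half of T(T - 2R) is the stated
  factor. It is the same for all graphs with \<open>k\<close> edges and can be pulled out of the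
  sum.\<close>

lemma total_weight_Suc_ge:
  assumes "D * n = 2 * N" "D * (D + 1) = 2 * R"
  shows "real (k + 1) * total_weight n D (Suc k) \<ge>
    2 * (real N - real k) * (real N - real k - real R) * total_weight n D k"
proof -
  let ?c = "2 * (real N - real k) * (real N - real k - real R)"
  have "(\<Sum>E\<in>bounded_graphs n D k. weight n D E * ?c) \<le>
    (\<Sum>E\<in>bounded_graphs n D k. weight n D E *
      (\<Sum>e\<in>nsets {1..n} 2 - E. \<Prod>v\<in>e. real (D - deg E v)))"
  proof (intro sum_mono mult_left_mono less_imp_le[OF weight_pos])
    fix E assume "E \<in> bounded_graphs n D k"
    from sum_nonedges_ge[OF this]
    show "?c \<le> (\<Sum>e\<in>nsets {1..n} 2 - E. \<Prod>v\<in>e. real (D - deg E v))"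
      unfolding assms by (simp add: algebra_simps)
  qed
  also have "\<dots> \<le> real (k + 1) * total_weight n D (Suc k)"
    by (rule total_weight_Suc_ge_sum_nonedges)
  finally show ?thesis
    by (simp add: total_weight_def sum_distrib_right[symmetric] mult.commute)
qed

text \<open>The right-hand side, divided by (N - k)!, is the product of the growth factors 2(N -
  j)(N - R - j)/(j + 1) over j < k. The recursion gives nothing beyond N - R edges, where the factor
  vanishes.\<close>

lemma total_weight_ge:
  assumes "D * n = 2 * N" "D * (D + 1) = 2 * R" "R \<le> N" "k \<le> N - R"
  shows "total_weight n D k * fact (N - k) \<ge> 2 ^ k * real (N - R choose k) * fact N"
  using assms(4)
proof (induction k)
  case 0
  then show ?case using total_weight_0[of n D] by simp
next
  case (Suc k)
  have Nk: "N - k = Suc (N - Suc k)" using Suc.prems by simp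
  have f: "(fact (N - k) :: real) = real (N - k) * fact (N - Suc k)"
    unfolding Nk by (simp add: fact_Suc)
  have b: "Suc k * (N - R choose Suc k) = (N - R - k) * (N - R choose k)"
    by (metis binomial_absorb_comp binomial_absorption mult.commute)
  have "real (k + 1) * (2 ^ Suc k * real (N - R choose Suc k) * fact N)
      = 2 ^ Suc k * real (Suc k * (N - R choose Suc k)) * fact N"
    by (simp only: of_nat_mult Suc_eq_plus1 mult_ac)
  also have "\<dots> = 2 * real (N - R - k) * (2 ^ k * real (N - R choose k) * fact N)"
    unfolding b by simp
  also have "\<dots> \<le> 2 * real (N - R - k) * (total_weight n D k * fact (N - k))"
    using Suc by (intro mult_left_mono) auto
  also have "\<dots> = (2 * (real N - real k) * (real N - real k - real R) * total_weight n D k) * fact (N - Suc k)"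
    unfolding f using Suc.prems assms(3) by (simp add: of_nat_diff algebra_simps)
  also have "\<dots> \<le> (real (k + 1) * total_weight n D (Suc k)) * fact (N - Suc k)"
    by (intro mult_right_mono total_weight_Suc_ge assms) simp
  finally have "real (k + 1) * (2 ^ Suc k * real (N - R choose Suc k) * fact N) \<le>
      real (k + 1) * (total_weight n D (Suc k) * fact (N - Suc k))"
    by (simp only: mult.assoc)
  then show ?case by (rule mult_left_le_imp_le) simp
qed

text \<open>At k = N - R the binomial coefficient is 1. Bounding every weight by
  \<open>fact D ^ n\<close> turns total weight into a number of graphs, and \<open>R\<close>
  switchings supply the missing edges; they need 4R < N - R, whence
  \<open>5 * R < N\<close>.\<close>

lemma card_regular_graphs_ge:
  assumes "D * n = 2 * N" "D * (D + 1) = 2 * R" "5 * R < N"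
  shows "2 ^ (N - R) * fact N \<le>
    fact R * fact D ^ n * real n ^ (6 * R) * real (card (regular_graphs n D))"
proof -
  have "2 ^ (N - R) * fact N \<le> total_weight n D (N - R) * fact R"
    using total_weight_ge[OF assms(1,2), of "N - R"] assms(3) by simp
  also have "total_weight n D (N - R) \<le> (\<Sum>E\<in>bounded_graphs n D (N - R). fact D ^ n)"
    unfolding total_weight_def by (intro sum_mono weight_le)
  also have "\<dots> = fact D ^ n * real (card (bounded_graphs n D (N - R)))"
    by simp
  also have "\<dots> \<le> fact D ^ n * real (n ^ (6 * R) * card (regular_graphs n D))"
    using assms by (intro mult_left_mono of_nat_mono card_bounded_graphs_le_regular_graphs)
      (auto simp: algebra_simps)
  finally show ?thesis by (simp add: mult_ac)
qed


subsection \<open>Graphs with a frozen colouring\<close>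

definition frozen_graphs :: "nat \<Rightarrow> nat \<Rightarrow> (nat \<Rightarrow> nat) \<Rightarrow> edges set" where
  "frozen_graphs n D \<alpha> = {E \<in> regular_graphs n D. frozen_colouring n E (D + 1) \<alpha>}"

definition colour_class :: "nat \<Rightarrow> (nat \<Rightarrow> nat) \<Rightarrow> nat \<Rightarrow> nat set" where
  "colour_class n \<alpha> i = {v \<in> {1..n}. \<alpha> v = i}"

text \<open>The description is meaningful for a frozen colouring, a vertex \<open>v\<close> and a
  colour \<open>j\<close> other than that of \<open>v\<close>; it is used only there.\<close>

definition coloured_nbr :: "edges \<Rightarrow> (nat \<Rightarrow> nat) \<Rightarrow> nat \<Rightarrow> nat \<Rightarrow> nat" where
  "coloured_nbr E \<alpha> j v = (THE w. w \<in> nbhd E v \<and> \<alpha> w = j)"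

lemma finite_regular_graphs: "finite (regular_graphs n D)"
  unfolding regular_graphs_def by (simp add: finite_simple_graphs)

lemma frozen_graphsD:
  assumes "E \<in> frozen_graphs n D \<alpha>"
  shows "E \<in> simple_graphs n" "v \<in> {1..n} \<Longrightarrow> deg E v = D" "\<alpha> \<in> {1..n} \<rightarrow>\<^sub>E {1..D + 1}"
    "w \<in> nbhd E v \<Longrightarrow> \<alpha> v \<noteq> \<alpha> w" "v \<in> {1..n} \<Longrightarrow> {1..D + 1} \<subseteq> \<alpha> ` closed_nbhd E v"
    "w \<in> nbhd E v \<Longrightarrow> w \<in> {1..n}"
proof -
  have E: "E \<in> simple_graphs n" "\<forall>v\<in>{1..n}. deg E v = D" "\<alpha> \<in> {1..n} \<rightarrow>\<^sub>E {1..D + 1}"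
    "\<forall>x y. {x, y} \<in> E \<longrightarrow> \<alpha> x \<noteq> \<alpha> y" "\<forall>v\<in>{1..n}. {1..D + 1} \<subseteq> \<alpha> ` closed_nbhd E v"
    using assms
    unfolding frozen_graphs_def regular_graphs_def frozen_colouring_def proper_colouring_def
    by blast+
  then show "E \<in> simple_graphs n" "v \<in> {1..n} \<Longrightarrow> deg E v = D" "\<alpha> \<in> {1..n} \<rightarrow>\<^sub>E {1..D + 1}"
    "v \<in> {1..n} \<Longrightarrow> {1..D + 1} \<subseteq> \<alpha> ` closed_nbhd E v"
    by blast+
  show "w \<in> nbhd E v \<Longrightarrow> \<alpha> v \<noteq> \<alpha> w"
    using E(4) by (simp add: nbhd_def)
  show "w \<in> nbhd E v \<Longrightarrow> w \<in> {1..n}"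
    using nbhd_subset[OF E(1)] by blast
qed

text \<open>The closed neighbourhood has D + 1 vertices and shows all D + 1 colours, so no colour
  repeats.\<close>

lemma frozen_inj_on_closed_nbhd:
  assumes "E \<in> frozen_graphs n D \<alpha>" "v \<in> {1..n}"
  shows "inj_on \<alpha> (closed_nbhd E v)"
proof -
  note E = frozen_graphsD[OF assms(1)]
  have fin: "finite (closed_nbhd E v)"
    by (simp add: closed_nbhd_def finite_nbhd[OF E(1)])
  have "card (closed_nbhd E v) = D + 1"
    using E(2)[OF assms(2)] nbhd_subset[OF E(1), of v] finite_nbhd[OF E(1)]
    by (auto simp: closed_nbhd_def card_insert_if)
  moreover have "card {1..D + 1} \<le> card (\<alpha> ` closed_nbhd E v)"
    using E(5)[OF assms(2)] fin by (intro card_mono) auto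
  ultimately show ?thesis
    using fin card_image_le[OF fin, of \<alpha>] by (intro eq_card_imp_inj_on) auto
qed

lemma coloured_nbr_unique:
  assumes "E \<in> frozen_graphs n D \<alpha>" "v \<in> {1..n}" "w \<in> nbhd E v"
  shows "coloured_nbr E \<alpha> (\<alpha> w) v = w"
  unfolding coloured_nbr_def
proof (rule the_equality)
  fix w' assume "w' \<in> nbhd E v \<and> \<alpha> w' = \<alpha> w"
  then show "w' = w"
    using frozen_inj_on_closed_nbhd[OF assms(1,2)] assms(3)
    by (auto simp: closed_nbhd_def dest: inj_onD)
qed (use assms in simp)

lemma coloured_nbr:
  assumes "E \<in> frozen_graphs n D \<alpha>" "v \<in> {1..n}" "j \<in> {1..D + 1}" "\<alpha> v \<noteq> j"
  shows "coloured_nbr E \<alpha> j v \<in> nbhd E v" "\<alpha> (coloured_nbr E \<alpha> j v) = j"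
proof -
  obtain w where "w \<in> closed_nbhd E v" "\<alpha> w = j"
    using frozen_graphsD(5)[OF assms(1,2)] assms(3) by auto
  then have "w \<in> nbhd E v" "\<alpha> w = j" using assms(4) by (auto simp: closed_nbhd_def)
  then show "coloured_nbr E \<alpha> j v \<in> nbhd E v" "\<alpha> (coloured_nbr E \<alpha> j v) = j"
    using coloured_nbr_unique[OF assms(1,2)] by auto
qed

text \<open>The \<open>j\<close>-coloured neighbour of \<open>v\<close> has only one neighbour of
  colour \<open>i\<close>, so it determines \<open>v\<close>.\<close>

lemma coloured_nbr_inj:
  assumes "E \<in> frozen_graphs n D \<alpha>" "j \<in> {1..D + 1}" "i \<noteq> j"
  shows "coloured_nbr E \<alpha> j ` colour_class n \<alpha> i \<subseteq> colour_class n \<alpha> j"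
    "inj_on (coloured_nbr E \<alpha> j) (colour_class n \<alpha> i)"
proof -
  note E = frozen_graphsD[OF assms(1)]
  have nbr: "coloured_nbr E \<alpha> j v \<in> nbhd E v" "\<alpha> (coloured_nbr E \<alpha> j v) = j"
    if "v \<in> colour_class n \<alpha> i" for v
    using coloured_nbr[OF assms(1) _ assms(2), of v] assms(3) that by (auto simp: colour_class_def)
  show "coloured_nbr E \<alpha> j ` colour_class n \<alpha> i \<subseteq> colour_class n \<alpha> j"
    using nbr E(6) unfolding colour_class_def[of _ _ j] by blast
  show "inj_on (coloured_nbr E \<alpha> j) (colour_class n \<alpha> i)"
  proof (rule inj_onI)
    fix v v' assume v: "v \<in> colour_class n \<alpha> i" "v' \<in> colour_class n \<alpha> i"
      and eq: "coloured_nbr E \<alpha> j v = coloured_nbr E \<alpha> j v'"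
    let ?w = "coloured_nbr E \<alpha> j v"
    have "?w \<in> {1..n}" "v \<in> nbhd E ?w" "v' \<in> nbhd E ?w"
      using nbr(1) v eq E(6) nbhd_sym by metis+
    then have "coloured_nbr E \<alpha> (\<alpha> v) ?w = v" "coloured_nbr E \<alpha> (\<alpha> v') ?w = v'"
      using coloured_nbr_unique[OF assms(1)] by blast+
    moreover have "\<alpha> v = \<alpha> v'"
      using v by (simp add: colour_class_def)
    ultimately show "v = v'" by metis
  qed
qed

text \<open>Injections exist between any two classes in both directions, so all D + 1 classes have
  the same size.\<close>

lemma card_colour_class:
  assumes "E \<in> frozen_graphs n D \<alpha>" "i \<in> {1..D + 1}"
  shows "card (colour_class n \<alpha> i) * (D + 1) = n"
proof -
  have fin: "finite (colour_class n \<alpha> i)" for i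
    by (simp add: colour_class_def)
  have le: "card (colour_class n \<alpha> i) \<le> card (colour_class n \<alpha> j)" if "j \<in> {1..D + 1}" for i j
    using card_inj_on_le[OF coloured_nbr_inj(2,1)[OF assms(1) that] fin] by (cases "i = j") auto
  have "\<alpha> ` {1..n} \<subseteq> {1..D + 1}"
    using frozen_graphsD(3)[OF assms(1)] by blast
  then have "card {1..n} = (\<Sum>j=1..D + 1. card (colour_class n \<alpha> j))"
    unfolding colour_class_def card_eq_sum by (intro sum.group[symmetric]) auto
  also have "\<dots> = (\<Sum>j=1..D + 1. card (colour_class n \<alpha> i))"
    using le assms(2) by (intro sum.cong antisym) auto
  finally show ?thesis by (simp add: mult.commute)
qed

text \<open>These index pairs are the pairs of distinct colours; for k = D + 1 there are
  \<open>R\<close> of them.\<close>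

lemma card_strict_pairs: "2 * card (SIGMA j:{1..k::nat}. {1..<j}) = k * (k - 1)"
proof (induction k)
  case (Suc k)
  then show ?case by (cases k) (simp_all add: card_SigmaI algebra_simps)
qed simp

text \<open>The ends of an edge have different colours, so the edge is recovered from its end of
  smaller colour by one of the maps with i < j.\<close>

lemma frozen_graphs_subset:
  assumes "E \<in> frozen_graphs n D \<alpha>" "E' \<in> frozen_graphs n D \<alpha>"
    and eq: "\<And>i j v. \<lbrakk>i < j; j \<in> {1..D + 1}; 1 \<le> i; v \<in> colour_class n \<alpha> i\<rbrakk> \<Longrightarrow>
      coloured_nbr E \<alpha> j v = coloured_nbr E' \<alpha> j v"
  shows "E \<subseteq> E'"
proof
  note E = frozen_graphsD[OF assms(1)]
  fix e assume "e \<in> E"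
  then obtain x y where "e = {x, y}" "x \<in> {1..n}" "y \<in> {1..n}" "x \<noteq> y"
    using E(1) simple_graph_edgeE by blast
  moreover from this have "\<alpha> x \<noteq> \<alpha> y"
    using E(4)[of y x] \<open>e \<in> E\<close> by (simp add: nbhd_def)
  ultimately obtain v w where vw: "e = {v, w}" "v \<in> {1..n}" "w \<in> {1..n}" "\<alpha> v < \<alpha> w"
    by (metis insert_commute nat_neq_iff)
  have "\<alpha> v \<in> {1..D + 1}" "\<alpha> w \<in> {1..D + 1}"
    using vw E(3) by blast+
  then have "coloured_nbr E \<alpha> (\<alpha> w) v = coloured_nbr E' \<alpha> (\<alpha> w) v"
    and "coloured_nbr E' \<alpha> (\<alpha> w) v \<in> nbhd E' v"
    using vw coloured_nbr(1)[OF assms(2)] by (auto intro!: eq simp: colour_class_def)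
  moreover have "coloured_nbr E \<alpha> (\<alpha> w) v = w"
    using \<open>e \<in> E\<close> vw by (intro coloured_nbr_unique[OF assms(1)]) (auto simp: nbhd_def)
  ultimately show "e \<in> E'" by (simp add: nbhd_def vw(1))
qed

text \<open>A graph is encoded by its neighbour maps between colour classes i < j. Each is an
  injection between sets of size \<open>m\<close>, with m! possibilities, and there are
  \<open>R\<close> pairs of colours.\<close>

lemma card_frozen_graphs_le:
  assumes "m * (D + 1) = n" "D * (D + 1) = 2 * R"
  shows "card (frozen_graphs n D \<alpha>) \<le> fact m ^ R"
proof (cases "frozen_graphs n D \<alpha> = {}")
  case False
  let ?A = "colour_class n \<alpha>"
  let ?P = "SIGMA j:{1..D + 1}. {1..<j}"
  let ?I = "\<lambda>(j, i). {f \<in> ?A i \<rightarrow>\<^sub>E ?A j. inj_on f (?A i)}"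
  \<comment> \<open>The restrictions make each map extensional, so that the code lies in a finite
    product of function sets.\<close>
  define \<Phi> where "\<Phi> E = (\<lambda>(j, i)\<in>?P. restrict (coloured_nbr E \<alpha> j) (?A i))" for E
  have fin: "finite (?A i)" for i
    by (simp add: colour_class_def)
  have card_A: "card (?A i) = m" if "i \<in> {1..D + 1}" for i
  proof -
    have "card (?A i) * (D + 1) = m * (D + 1)"
      using False card_colour_class[OF _ that] assms(1) by blast
    then show ?thesis by (simp only: mult_cancel2) simp
  qed
  have "card (?I p) = fact m" if "p \<in> ?P" for p
  proof -
    obtain j i where p: "p = (j, i)" by fastforce
    with that have "i \<in> {1..D + 1}" "j \<in> {1..D + 1}" by auto
    then have "card (?I p) = m ^ 0 * prod ((-) m) {0..<m}"
      using card_inj_on_subset_funcset[OF fin fin order.refl, of i j] card_A p by simp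
    then show ?thesis by (simp add: fact_prod_rev)
  qed
  then have card_Pi: "card (PiE ?P ?I) = fact m ^ card ?P"
    by (subst card_PiE) auto
  have inj: "inj_on \<Phi> (frozen_graphs n D \<alpha>)"
  proof (rule inj_onI)
    fix E E' assume E: "E \<in> frozen_graphs n D \<alpha>" "E' \<in> frozen_graphs n D \<alpha>" and eq: "\<Phi> E = \<Phi> E'"
    have "coloured_nbr E \<alpha> j v = coloured_nbr E' \<alpha> j v"
      if "i < j" "j \<in> {1..D + 1}" "1 \<le> i" "v \<in> ?A i" for i j v
      using fun_cong[OF fun_cong[OF eq], of "(j, i)" v] that by (simp add: \<Phi>_def)
    then show "E = E'"
      using E frozen_graphs_subset by (metis subset_antisym)
  qed
  have sub: "\<Phi> ` frozen_graphs n D \<alpha> \<subseteq> PiE ?P ?I"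
  proof (rule image_subsetI)
    fix E assume E: "E \<in> frozen_graphs n D \<alpha>"
    have "restrict (coloured_nbr E \<alpha> j) (?A i) \<in> ?I (j, i)" if "(j, i) \<in> ?P" for j i
    proof -
      have "j \<in> {1..D + 1}" "i \<noteq> j" using that by auto
      then show ?thesis
        using coloured_nbr_inj[OF E] by (auto simp: image_subset_iff inj_on_restrict_eq)
    qed
    then have "\<forall>p\<in>?P. (case p of (j, i) \<Rightarrow> restrict (coloured_nbr E \<alpha> j) (?A i)) \<in> ?I p"
      by (metis (no_types, lifting) case_prod_conv surj_pair)
    then show "\<Phi> E \<in> PiE ?P ?I"
      unfolding \<Phi>_def restrict_PiE_iff .
  qed
  have "finite (?I p)" for p
    by (rule finite_subset[of _ "?A (snd p) \<rightarrow>\<^sub>E ?A (fst p)"])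
      (auto intro!: finite_PiE fin split: prod.splits)
  then have "finite (PiE ?P ?I)"
    by (intro finite_PiE) auto
  from card_inj_on_le[OF inj sub this] have "card (frozen_graphs n D \<alpha>) \<le> fact m ^ card ?P"
    unfolding card_Pi .
  moreover have "2 * card ?P = 2 * R"
    using card_strict_pairs[of "D + 1"] assms(2)
    by (simp only: add_diff_cancel_right' mult.commute)
  then have "card ?P = R" by (simp only: mult_cancel1) simp
  ultimately show ?thesis by (simp only:)
qed simp

text \<open>Colourings are extensional on the vertex set, so a union bound over finitely many of
  them is possible.\<close>

lemma frozen_colourable_eq_UN:
  "regular_graphs n D \<inter> {E. \<exists>\<alpha>. frozen_colouring n E (D + 1) \<alpha>} =
    (\<Union>\<alpha>\<in>{1..n} \<rightarrow>\<^sub>E {1..D + 1}. frozen_graphs n D \<alpha>)"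
proof -
  have "\<alpha> \<in> {1..n} \<rightarrow>\<^sub>E {1..D + 1}" if "frozen_colouring n E (D + 1) \<alpha>" for E \<alpha>
    using that unfolding frozen_colouring_def proper_colouring_def by blast
  then show ?thesis unfolding frozen_graphs_def by blast
qed

lemma card_frozen_colourable_le:
  assumes "m * (D + 1) = n" "D * (D + 1) = 2 * R"
  shows "card (regular_graphs n D \<inter> {E. \<exists>\<alpha>. frozen_colouring n E (D + 1) \<alpha>})
    \<le> (D + 1) ^ n * fact m ^ R"
proof -
  have "card (\<Union>\<alpha>\<in>{1..n} \<rightarrow>\<^sub>E {1..D + 1}. frozen_graphs n D \<alpha>)
      \<le> (\<Sum>\<alpha>\<in>{1..n} \<rightarrow>\<^sub>E {1..D + 1}. card (frozen_graphs n D \<alpha>))"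
    by (intro card_UN_le finite_PiE) auto
  also have "\<dots> \<le> (\<Sum>\<alpha>\<in>{1..n} \<rightarrow>\<^sub>E {1..D + 1}. fact m ^ R)"
    by (intro sum_mono card_frozen_graphs_le assms)
  also have "\<dots> = (D + 1) ^ n * fact m ^ R"
    by (simp add: card_PiE)
  finally show ?thesis unfolding frozen_colourable_eq_UN .
qed

lemma not_frozen_colourable:
  assumes "\<not> (D + 1) dvd n"
  shows "regular_graphs n D \<inter> {E. \<exists>\<alpha>. frozen_colouring n E (D + 1) \<alpha>} = {}"
proof (rule equals0I)
  fix E assume "E \<in> regular_graphs n D \<inter> {E. \<exists>\<alpha>. frozen_colouring n E (D + 1) \<alpha>}"
  then obtain \<alpha> where "E \<in> frozen_graphs n D \<alpha>"
    unfolding frozen_colourable_eq_UN by blast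
  then have "card (colour_class n \<alpha> 1) * (D + 1) = n"
    by (rule card_colour_class) simp
  then have "(D + 1) dvd n" by (metis dvd_triv_right)
  with assms show False by contradiction
qed

subsection \<open>The first moment estimate\<close>

lemma fact_times_power_le: "fact a * a ^ k \<le> (fact (a + k) :: nat)"
proof (induction k)
  case (Suc k)
  have "fact a * a ^ Suc k = a * (fact a * a ^ k)" by simp
  also have "\<dots> \<le> Suc (a + k) * fact (a + k)"
    using Suc by (intro mult_mono) auto
  finally show ?case by simp
qed simp

text \<open>The multinomial coefficient (Rm)!/(m!)^R equals R^(Rm) up to a factor polynomial in
  \<open>m\<close>. Induction telescopes because each of the \<open>R\<close> new factors of (Rm +
  R)! is at least Rm.\<close>

lemma multinomial_ge:
  assumes "m \<ge> 1"
  shows "R ^ (R * m) * fact m ^ R \<le> fact (R * m) * (m * R) ^ R"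
  using assms
proof (induction m rule: dec_induct)
  case base
  then show ?case using fact_ge_1[of R, where 'a = nat] by simp
next
  case (step m)
  have e: "R * Suc m = R + R * m" by simp
  have "R ^ (R * Suc m) * fact (Suc m) ^ R = (R ^ (R * m) * fact m ^ R) * (Suc m * R) ^ R"
    unfolding e by (simp only: fact_Suc power_add power_mult_distrib of_nat_id mult_ac)
  also have "\<dots> \<le> (fact (R * m) * (m * R) ^ R) * (Suc m * R) ^ R"
    by (intro mult_le_mono1 step.IH)
  also have "\<dots> \<le> fact (R * m + R) * (Suc m * R) ^ R"
    using fact_times_power_le[of "R * m" R] by (intro mult_le_mono1) (simp add: mult.commute)
  finally show ?case by (simp add: add.commute)
qed

text \<open>This says that the exponential rate is below 1, squared and cleared of denominators. For
  D = 2 both sides equal 36, so the start at 3 is sharp. In the induction the left side grows by (D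
  + 2)^2 and the right side by at least as much.\<close>

lemma fact_Suc_square_less:
  assumes "D \<ge> 3"
  shows "(fact (D + 1) :: nat) ^ 2 < (D * (D + 1)) ^ D"
  using assms
proof (induction D rule: dec_induct)
  case base
  show ?case by (simp add: fact_numeral)
next
  case (step D)
  have e: "(D + 2) ^ (D + 1) = (D + 2) ^ 2 * (D + 2) ^ (D - 1)"
    using step.hyps by (simp flip: power_add)
  have "D ^ D = D * D ^ (D - 1)"
    using step.hyps by (cases D) auto
  also have "\<dots> \<le> (D + 1) * (D + 2) ^ (D - 1)"
    by (intro mult_mono power_mono) auto
  finally have "D ^ D \<le> (D + 1) * (D + 2) ^ (D - 1)" .
  then have "(D + 2) ^ 2 * D ^ D * (D + 1) ^ D \<le> (D + 2) ^ 2 * ((D + 1) * (D + 2) ^ (D - 1)) * (D + 1) ^ D"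
    by (intro mult_le_mono1 mult_le_mono2)
  also have "(D + 2) ^ 2 * ((D + 1) * (D + 2) ^ (D - 1)) * (D + 1) ^ D = ((D + 1) * (D + 2)) ^ (D + 1)"
    unfolding power_mult_distrib e by (simp only: power_add power_one_right mult_ac)
  finally have *: "(D + 2) ^ 2 * (D * (D + 1)) ^ D \<le> ((D + 1) * (D + 2)) ^ (D + 1)"
    by (simp only: power_mult_distrib mult.assoc)
  have "(fact (D + 2) :: nat) = (D + 2) * fact (D + 1)"
    using fact_Suc[of "D + 1", where 'a = nat] by (simp del: fact_Suc)
  then have "(fact (D + 2) :: nat) ^ 2 = (D + 2) ^ 2 * fact (D + 1) ^ 2"
    by (simp only: power_mult_distrib)
  also have "\<dots> < (D + 2) ^ 2 * (D * (D + 1)) ^ D"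
    using step.IH by (intro mult_strict_left_mono) auto
  also note *
  finally show ?case by simp
qed

text \<open>The count of frozen graphs is compared with the lower bound for all regular graphs.
  Since R m is the number of edges, the power of 2R is (D(D + 1))^(Dn/2).\<close>

lemma frozen_first_moment:
  assumes "m * (D + 1) = n" "D * (D + 1) = 2 * R" "n > 10 * (D + 1)" "D \<ge> 1"
  shows "real (card (regular_graphs n D \<inter> {E. \<exists>\<alpha>. frozen_colouring n E (D + 1) \<alpha>})) *
      real (2 * R) ^ (R * m)
    \<le> fact R * real (2 * R) ^ R * real n ^ (7 * R) * fact (D + 1) ^ n * real (card (regular_graphs n D))"
    (is "?F * _ \<le> _")
proof -
  let ?N = "R * m"
  have N: "D * n = 2 * ?N"
    using assms(1,2) by (metis mult.assoc mult.commute)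
  have "m > 10"
    using assms(1,3) by (metis mult.commute nat_mult_less_cancel_disj)
  have "m \<le> n" using assms(1) by auto
  have "R > 0" using assms(2,4) by (cases R) auto
  have "?F * real (2 * R) ^ ?N \<le> real ((D + 1) ^ n * fact m ^ R) * real (2 * R) ^ ?N"
    using card_frozen_colourable_le[OF assms(1,2)] by (intro mult_right_mono of_nat_mono) auto
  also have "\<dots> = real ((D + 1) ^ n) * 2 ^ ?N * real (R ^ ?N * fact m ^ R)"
    by (simp add: power_mult_distrib)
  \<comment> \<open>This replaces (m!)^R by N!/R^N up to a polynomial factor, and N! is what the
    lower bound for regular graphs contains.\<close>
  also have "\<dots> \<le> real ((D + 1) ^ n) * 2 ^ ?N * real (fact ?N * (m * R) ^ R)"
    using multinomial_ge[of m R] \<open>m > 10\<close> by (intro mult_left_mono of_nat_mono) auto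
  also have "\<dots> = real ((D + 1) ^ n) * real (2 * R) ^ R * real m ^ R * (2 ^ (?N - R) * fact ?N)"
  proof -
    have "(2::real) ^ ?N = 2 ^ R * 2 ^ (?N - R)"
      using \<open>m > 10\<close> by (simp flip: power_add)
    then show ?thesis by (simp add: power_mult_distrib)
  qed
  also have "\<dots> \<le> real ((D + 1) ^ n) * real (2 * R) ^ R * real n ^ R *
      (fact R * fact D ^ n * real n ^ (6 * R) * real (card (regular_graphs n D)))"
    using \<open>m > 10\<close> \<open>m \<le> n\<close> \<open>R > 0\<close>
    by (intro mult_mono power_mono card_regular_graphs_ge[OF N assms(2)]) auto
  also have "\<dots> = fact R * real (2 * R) ^ R * (real n ^ R * real n ^ (6 * R)) *
      (real ((D + 1) ^ n) * fact D ^ n) * real (card (regular_graphs n D))"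
    by (simp only: mult_ac)
  also have "real n ^ R * real n ^ (6 * R) = real n ^ (7 * R)"
    by (simp flip: power_add)
  also have "real ((D + 1) ^ n) * fact D ^ n = fact (D + 1) ^ n"
    by (simp flip: power_mult_distrib)
  finally show ?thesis .
qed

lemma prob_frozen_le:
  assumes "D \<ge> 1" "D * (D + 1) = 2 * R" "n > 10 * (D + 1)" "even (D * n)"
  shows "measure_pmf.prob (random_regular_graph n D) {E. \<exists>\<alpha>. frozen_colouring n E (D + 1) \<alpha>}
    \<le> fact R * real (2 * R) ^ R * real n ^ (7 * R) * (fact (D + 1) / sqrt (real (D * (D + 1))) ^ D) ^ n"
proof -
  let ?X = "{E. \<exists>\<alpha>. frozen_colouring n E (D + 1) \<alpha>}"
  let ?C = "fact R * real (2 * R) ^ R * real n ^ (7 * R)"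
  let ?r = "card (regular_graphs n D)"
  define N where "N = D * n div 2"
  have N: "D * n = 2 * N" using assms(4) by (simp add: N_def)
  have "D * (10 * (D + 1)) < D * n"
    using assms(1,3) by simp
  then have "5 * R < N"
    using N assms(2) by (simp add: algebra_simps)
  \<comment> \<open>The lower bound also yields existence of regular graphs, without which
    \<open>pmf_of_set\<close> is not the uniform distribution.\<close>
  have r: "?r > 0"
  proof (rule ccontr)
    assume "\<not> ?r > 0"
    then have "2 ^ (N - R) * fact N \<le> (0 :: real)"
      using card_regular_graphs_ge[OF N assms(2) \<open>5 * R < N\<close>] by simp
    moreover have "2 ^ (N - R) * fact N > (0 :: real)" by simp
    ultimately show False by linarith
  qed
  then have "regular_graphs n D \<noteq> {}" by auto
  then have prob: "measure_pmf.prob (random_regular_graph n D) ?X = card (regular_graphs n D \<inter> ?X) / ?r"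
    unfolding random_regular_graph_def by (intro measure_pmf_of_set finite_regular_graphs)
  show ?thesis
  \<comment> \<open>Equal colour classes force D + 1 to divide \<open>n\<close>; otherwise the
    probability is 0.\<close>
  proof (cases "(D + 1) dvd n")
    case True
    then obtain m where m: "m * (D + 1) = n" by (metis dvd_div_mult_self)
    have "2 * N = 2 * (R * m)"
      using m assms(2) N by (metis mult.assoc mult.commute)
    \<comment> \<open>The square root encodes the exponent D/2 for odd \<open>D\<close> too; D n =
      2Rm removes it.\<close>
    then have "sqrt (real (D * (D + 1))) ^ (D * n) = (sqrt (real (2 * R)) ^ 2) ^ (R * m)"
      by (simp only: N assms(2) power_mult)
    then have q: "(sqrt (real (D * (D + 1))) ^ D) ^ n = real (2 * R) ^ (R * m)"
      by (simp flip: power_mult)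
    have R: "real (2 * R) ^ (R * m) > 0"
      using assms(1,2) by (intro zero_less_power) (cases R; auto)
    have "real (card (regular_graphs n D \<inter> ?X)) * real (2 * R) ^ (R * m) \<le> ?C * fact (D + 1) ^ n * ?r"
      by (rule frozen_first_moment[OF m assms(2,3,1)])
    then show ?thesis
      unfolding prob power_divide q using r R by (simp add: field_simps)
  next
    case False
    have "card (regular_graphs n D \<inter> ?X) = 0"
      unfolding not_frozen_colourable[OF False] by simp
    then show ?thesis unfolding prob by simp
  qed
qed

theorem proposition6:
  fixes \<Delta> :: nat
  assumes "\<Delta> \<ge> 3"
  shows "\<exists>(c::real) (n\<^sub>0::nat). c > 0 \<and> n\<^sub>0 > 0 \<and>
    (\<forall>n\<ge>n\<^sub>0. even (\<Delta> * n) \<longrightarrow>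
      measure_pmf.prob (random_regular_graph n \<Delta>)
        {E. \<exists>\<alpha>. frozen_colouring n E (\<Delta> + 1) \<alpha>} \<le> exp (- c * real n))"
proof -
  obtain R where R: "\<Delta> * (\<Delta> + 1) = 2 * R"
    by (metis dvdE even_mult_iff even_plus_one_iff)
  define q :: real where "q = fact (\<Delta> + 1) / sqrt (real (\<Delta> * (\<Delta> + 1))) ^ \<Delta>"
  define C :: real where "C = fact R * real (2 * R) ^ R"
  have pos: "real (\<Delta> * (\<Delta> + 1)) > 0" using assms by (simp only: of_nat_0_less_iff) simp
  then have q_pos: "q > 0" unfolding q_def by simp
  have "(sqrt x ^ \<Delta>) ^ 2 = x ^ \<Delta>" if "x > 0" for x
    using that by (simp add: power_even_eq[symmetric] power_mult)
  then have "q ^ 2 = fact (\<Delta> + 1) ^ 2 / real (\<Delta> * (\<Delta> + 1)) ^ \<Delta>"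
    unfolding q_def power_divide using pos by metis
  also have "\<dots> = real (fact (\<Delta> + 1) ^ 2) / real ((\<Delta> * (\<Delta> + 1)) ^ \<Delta>)"
    by (simp only: of_nat_power of_nat_fact)
  also have "\<dots> < 1"
    using fact_Suc_square_less[OF assms, folded of_nat_less_iff[where 'a = real]]
    by (metis divide_less_eq_1_pos of_nat_0_le_iff order.strict_trans1)
  finally have "q < 1"
    using q_pos by (simp add: power_less_one_iff)
  \<comment> \<open>Half of the decay rate is given up: \<open>q ^ n\<close> is the square of
    \<open>exp (- c * real n)\<close>, and one of the two factors absorbs the polynomial.\<close>
  define c where "c = - ln q / 2"
  have c: "c > 0" using q_pos \<open>q < 1\<close> by (simp add: c_def)
  have qn: "q ^ n = exp (- c * real n) * exp (- c * real n)" for n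
  proof -
    have "q ^ n = exp (real n * ln q)"
      using q_pos by (simp add: exp_of_nat_mult)
    also have "real n * ln q = - c * real n + - c * real n"
      by (simp add: c_def)
    finally show ?thesis by (simp only: exp_add)
  qed
  have "eventually (\<lambda>n. C * real n ^ (7 * R) * exp (- c * real n) \<le> 1) at_top"
    using c by real_asymp
  then obtain n1 where n1: "\<And>n. n \<ge> n1 \<Longrightarrow> C * real n ^ (7 * R) * exp (- c * real n) \<le> 1"
    by (auto simp: eventually_at_top_linorder)
  have "measure_pmf.prob (random_regular_graph n \<Delta>) {E. \<exists>\<alpha>. frozen_colouring n E (\<Delta> + 1) \<alpha>}
      \<le> exp (- c * real n)"
    if n: "n \<ge> max n1 (10 * (\<Delta> + 1) + 1)" and ev: "even (\<Delta> * n)" for n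
  proof -
    have "measure_pmf.prob (random_regular_graph n \<Delta>) {E. \<exists>\<alpha>. frozen_colouring n E (\<Delta> + 1) \<alpha>}
        \<le> C * real n ^ (7 * R) * q ^ n"
      unfolding C_def q_def using n by (intro prob_frozen_le R ev) (use assms in auto)
    also have "\<dots> = (C * real n ^ (7 * R) * exp (- c * real n)) * exp (- c * real n)"
      by (simp only: qn mult.assoc)
    also have "\<dots> \<le> 1 * exp (- c * real n)"
      using n by (intro mult_right_mono n1) auto
    finally show ?thesis by simp
  qed
  moreover have "max n1 (10 * (\<Delta> + 1) + 1) > 0" by simp
  ultimately show ?thesis using c by blast
qed

end
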